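(* Let $H$ be a real Hilbert space, let $u_0\in H$ and $R>0$, let $L$ be a densely defined linear operator in $H$ with domain $D(L)$ such that $L^*=L\ge 0$, and let $g:H\to H$ be a (nonlinear) $C^2_{loc}$ map with $g'(u)\ge 0$ for all $u\in H$. Assume that the equation $F(v):=Lv+g(v)=0$ is solvable and let $v$ be its (unique) minimal-norm solution. For a constant $\varepsilon>0$ define $$\Phi(u):=-[I+(L+\varepsilon I)^{-1}g'(u)]^{-1}[u+(L+\varepsilon I)^{-1}g(u)].$$ Assume that for each $\varepsilon>0$ there is a constant $m_1=m_1(\varepsilon)>0$ such that $I+(L+\varepsilon I)^{-1}g'(u)$ is boundedly invertible for every $u\in B(u_0,R)$ and $$\sup_{u\in B(u_0,R)}\left\|[I+(L+\varepsilon I)^{-1}g'(u)]^{-1}\right\|\le m_1(\varepsilon).$$ Then, for each $\varepsilon>0$, the Cauchy problem $\dot u=\Phi(u)$, $u(0)=u_0$, has a unique global solution $u_\varepsilon(t)$; the limit $v_\varepsilon:=u_\varepsilon(\infty):=\lim_{t\to\infty}u_\varepsilon(t)$ exists in $H$; and $$Lv_\varepsilon+\varepsilon v_\varepsilon+g(v_\varepsilon)=0.$$ Moreover, the limit $\lim_{\varepsilon\to 0}v_\varepsilon$ exists (in the norm of $H$) and equals $v$, which is the unique minimal-norm solution to the equation $Lv+g(v)=0$.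
   Context: $B(u_0,R):=\{u\in H:\|u-u_0\|\le R\}$. The map $g:H\to H$ is called $C^2_{loc}$ if it is twice Fréchet differentiable and, for the given $u_0\in H$ and $R>0$, there are constants $c_0,c_1,c_2$ with $\sup_{u\in B(u_0,R)}\|g^{(j)}(u)\|\le c_j$ for $j=0,1,2$, where $g^{(j)}$ is the Fréchet derivative of order $j$ (and $g^{(0)}=g$, $g^{(1)}=g'$). For a linear operator $A$ in $H$, $A\ge 0$ means $(Ah,h)\ge 0$ for all $h$ in the domain of $A$. A solution of $Lv+g(v)=0$ is an element $v\in D(L)$ satisfying this equation; a minimal-norm solution is a solution whose norm is the smallest among all solutions. $\dot u=du/dt$, and $I$ is the identity operator on $H$. A global solution is one defined for all $t>0$. *)

theory Defs
  imports "HOL-Analysis.Analysis"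
begin

text \<open>
  An unbounded operator in \<open>H\<close> is a pair of its domain \<open>D\<close> and a total function \<open>L\<close>;
  the values of \<open>L\<close> outside \<open>D\<close> are irrelevant.
\<close>

definition linear_operator_on :: "'a::real_vector set \<Rightarrow> ('a \<Rightarrow> 'a) \<Rightarrow> bool" where
  "linear_operator_on D L \<longleftrightarrow>
     subspace D \<and>
     (\<forall>x\<in>D. \<forall>y\<in>D. L (x + y) = L x + L y) \<and>
     (\<forall>c. \<forall>x\<in>D. L (c *\<^sub>R x) = c *\<^sub>R L x)"

definition densely_defined :: "'a::topological_space set \<Rightarrow> bool" where
  "densely_defined D \<longleftrightarrow> closure D = UNIV"

definition adjoint_domain :: "'a::real_inner set \<Rightarrow> ('a \<Rightarrow> 'a) \<Rightarrow> 'a set" where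
  "adjoint_domain D L = {y. \<exists>z. \<forall>x\<in>D. L x \<bullet> y = x \<bullet> z}"

text \<open>The vector described here is unique when \<open>D\<close> is dense.\<close>

definition adjoint_operator :: "'a::real_inner set \<Rightarrow> ('a \<Rightarrow> 'a) \<Rightarrow> 'a \<Rightarrow> 'a" where
  "adjoint_operator D L y = (THE z. \<forall>x\<in>D. L x \<bullet> y = x \<bullet> z)"

definition selfadjoint_operator :: "'a::real_inner set \<Rightarrow> ('a \<Rightarrow> 'a) \<Rightarrow> bool" where
  "selfadjoint_operator D L \<longleftrightarrow>
     adjoint_domain D L = D \<and> (\<forall>y\<in>D. adjoint_operator D L y = L y)"

definition nonneg_operator :: "'a::real_inner set \<Rightarrow> ('a \<Rightarrow> 'a) \<Rightarrow> bool" where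
  "nonneg_operator D A \<longleftrightarrow> (\<forall>h\<in>D. 0 \<le> A h \<bullet> h)"

text \<open>
  \<open>g'\<close> and \<open>g''\<close> are the first and second Frechet derivatives of \<open>g\<close> on the whole space
  (hence determined by \<open>g\<close>); the bounds are required on the ball only.
\<close>

definition C2_loc ::
  "'a::real_normed_vector \<Rightarrow> real \<Rightarrow> ('a \<Rightarrow> 'a) \<Rightarrow> ('a \<Rightarrow> 'a \<Rightarrow>\<^sub>L 'a) \<Rightarrow>
   ('a \<Rightarrow> 'a \<Rightarrow>\<^sub>L ('a \<Rightarrow>\<^sub>L 'a)) \<Rightarrow> bool" where
  "C2_loc u\<^sub>0 R g g' g'' \<longleftrightarrow>
     (\<forall>u. (g has_derivative blinfun_apply (g' u)) (at u)) \<and>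
     (\<forall>u. (g' has_derivative blinfun_apply (g'' u)) (at u)) \<and>
     (\<exists>c\<^sub>0 c\<^sub>1 c\<^sub>2. \<forall>u\<in>cball u\<^sub>0 R.
        norm (g u) \<le> c\<^sub>0 \<and> norm (g' u) \<le> c\<^sub>1 \<and> norm (g'' u) \<le> c\<^sub>2)"

definition boundedly_invertible :: "('a::real_normed_vector \<Rightarrow> 'a) \<Rightarrow> bool" where
  "boundedly_invertible T \<longleftrightarrow> bij T \<and> bounded_linear (inv T)"

text \<open>The operator \<open>(L + \<epsilon>I)\<inverse>\<close>, with values in \<open>D\<close>.\<close>

definition shifted_inverse :: "'a::real_vector set \<Rightarrow> ('a \<Rightarrow> 'a) \<Rightarrow> real \<Rightarrow> 'a \<Rightarrow> 'a" where
  "shifted_inverse D L \<epsilon> = inv_into D (\<lambda>x. L x + \<epsilon> *\<^sub>R x)"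

text \<open>The operator \<open>I + (L + \<epsilon>I)\<inverse> g'(u)\<close>.\<close>

definition newton_operator ::
  "'a::real_normed_vector set \<Rightarrow> ('a \<Rightarrow> 'a) \<Rightarrow> ('a \<Rightarrow> 'a \<Rightarrow>\<^sub>L 'a) \<Rightarrow> real \<Rightarrow> 'a \<Rightarrow> 'a \<Rightarrow> 'a" where
  "newton_operator D L g' \<epsilon> u = (\<lambda>h. h + shifted_inverse D L \<epsilon> (blinfun_apply (g' u) h))"

definition newton_field ::
  "'a::real_normed_vector set \<Rightarrow> ('a \<Rightarrow> 'a) \<Rightarrow> ('a \<Rightarrow> 'a) \<Rightarrow> ('a \<Rightarrow> 'a \<Rightarrow>\<^sub>L 'a) \<Rightarrow>
   real \<Rightarrow> 'a \<Rightarrow> 'a" where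
  "newton_field D L g g' \<epsilon> u =
     - inv (newton_operator D L g' \<epsilon> u) (u + shifted_inverse D L \<epsilon> (g u))"

text \<open>The derivative at \<open>t = 0\<close> is one-sided; values of \<open>u\<close> at negative times are irrelevant.\<close>

definition global_solution ::
  "('a::real_normed_vector \<Rightarrow> 'a) \<Rightarrow> 'a \<Rightarrow> (real \<Rightarrow> 'a) \<Rightarrow> bool" where
  "global_solution \<Phi> u\<^sub>0 u \<longleftrightarrow>
     u 0 = u\<^sub>0 \<and> (\<forall>t\<ge>0. (u has_vector_derivative \<Phi> (u t)) (at t within {0..}))"

definition equation_solution :: "'a::real_vector set \<Rightarrow> ('a \<Rightarrow> 'a) \<Rightarrow> ('a \<Rightarrow> 'a) \<Rightarrow> 'a \<Rightarrow> bool" where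
  "equation_solution D L g v \<longleftrightarrow> v \<in> D \<and> L v + g v = 0"

definition minimal_norm_solution ::
  "'a::real_normed_vector set \<Rightarrow> ('a \<Rightarrow> 'a) \<Rightarrow> ('a \<Rightarrow> 'a) \<Rightarrow> 'a \<Rightarrow> bool" where
  "minimal_norm_solution D L g v \<longleftrightarrow>
     equation_solution D L g v \<and> (\<forall>w. equation_solution D L g w \<longrightarrow> norm v \<le> norm w)"

end

theory Submission
  imports Defs
begin

text \<open>
  Let \<open>G\<^sub>\<epsilon>(u) = u + (L + \<epsilon>I)\<inverse> g(u)\<close> (\<open>reg \<epsilon>\<close> below). The flow satisfies
  \<open>(G\<^sub>\<epsilon>(u(t)))' = - G\<^sub>\<epsilon>(u(t))\<close>, so everything reduces to \<open>G\<^sub>\<epsilon>\<close> being a bijection of \<open>H\<close> with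
  differentiable inverse: then \<open>u(t) = G\<^sub>\<epsilon>\<inverse>(e\<^sup>-\<^sup>t G\<^sub>\<epsilon>(u\<^sub>0))\<close> is the only solution and it tends to
  \<open>v\<^sub>\<epsilon> = G\<^sub>\<epsilon>\<inverse>(0)\<close>. Strong monotonicity of \<open>L + \<epsilon>I + g\<close> gives injectivity and continuity of
  the inverse; the range is open because the derivative of \<open>G\<^sub>\<epsilon>\<close> is invertible at every point of
  \<open>H\<close>, and closed by a local boundedness argument for monotone maps, hence it is all of \<open>H\<close>.

  For \<open>\<epsilon> < \<delta>\<close>, monotonicity gives
  \<open>\<parallel>v\<^sub>\<epsilon> - v\<^sub>\<delta>\<parallel>\<^sup>2 \<le> \<parallel>v\<^sub>\<epsilon>\<parallel>\<^sup>2 - \<parallel>v\<^sub>\<delta>\<parallel>\<^sup>2\<close>, and \<open>\<parallel>v\<^sub>\<epsilon>\<parallel> \<le> \<parallel>w\<parallel>\<close> for every solution \<open>w\<close>; so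
  \<open>v\<^sub>\<epsilon>\<close> converges strongly, without weak compactness, and closedness of \<open>L\<close> identifies the limit.
\<close>

section \<open>Closed subspaces of Hilbert spaces\<close>

lemma parallelogram_law:
  fixes x y :: "'a::real_inner"
  shows "(norm (x - y))\<^sup>2 + (norm (x + y))\<^sup>2 = 2 * (norm x)\<^sup>2 + 2 * (norm y)\<^sup>2"
  by (simp add: power2_norm_eq_inner inner_simps inner_commute)

text \<open>Transfers the Cauchy property from controlling data to the sequence of interest. It
  serves twice: for resolvent values over a convergent sequence in the range of the regularized map,
  and for regularized solutions controlled by their squared norms.\<close>

lemma Cauchy_if_dist_power2_le:
  fixes x :: "nat \<Rightarrow> 'a::metric_space" and y :: "nat \<Rightarrow> 'b::metric_space"
  assumes y: "Cauchy y" and le: "\<And>m n. (dist (x m) (x n))\<^sup>2 \<le> C * dist (y m) (y n)"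
  shows "Cauchy x"
proof (rule metric_CauchyI)
  fix e :: real assume "e > 0"
  \<comment> \<open>The constant \<open>C\<close> may be zero or negative; enlarging it to
    \<open>K\<close> makes the division by \<open>K\<close> safe.\<close>
  define K where "K = max C 1"
  have K: "K > 0" "C \<le> K" by (auto simp: K_def)
  obtain M where M: "\<And>m n. m \<ge> M \<Longrightarrow> n \<ge> M \<Longrightarrow> dist (y m) (y n) < e\<^sup>2 / K"
    using metric_CauchyD[OF y, of "e\<^sup>2 / K"] \<open>e > 0\<close> K by auto
  have "dist (x m) (x n) < e" if "m \<ge> M" "n \<ge> M" for m n
  proof -
    have "(dist (x m) (x n))\<^sup>2 \<le> K * dist (y m) (y n)"
      using le[of m n] mult_right_mono[OF K(2), of "dist (y m) (y n)"] by simp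
    also have "\<dots> < e\<^sup>2"
      using M[OF that] K by (simp add: field_simps)
    finally show ?thesis
      using \<open>e > 0\<close> power_less_imp_less_base by fastforce
  qed
  then show "\<exists>M. \<forall>m\<ge>M. \<forall>n\<ge>M. dist (x m) (x n) < e" by blast
qed

text \<open>A minimizing sequence is Cauchy by the parallelogram law, because midpoints of its
  members stay in \<open>M\<close> and hence keep distance at least \<open>d\<close> from
  \<open>f\<close>.\<close>

lemma closed_subspace_closest_point:
  fixes M :: "'a::{real_inner, complete_space} set"
  assumes M: "closed M" "subspace M"
  obtains y where "y \<in> M" "\<And>x. x \<in> M \<Longrightarrow> dist f y \<le> dist f x"
proof -
  have ne: "M \<noteq> {}" using subspace_0[OF M(2)] by auto
  define d where "d = infdist f M"
  have d: "0 \<le> d" "\<And>x. x \<in> M \<Longrightarrow> d \<le> norm (f - x)"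
    using infdist_nonneg infdist_le[of _ M f] by (auto simp: d_def dist_norm)
  have "\<exists>x\<in>M. norm (f - x) < d + 1 / Suc n" for n
  proof (rule ccontr)
    assume "\<not> ?thesis"
    then have "d + 1 / Suc n \<le> (INF x\<in>M. dist f x)"
      using ne by (intro cINF_greatest) (auto simp: dist_norm not_less)
    also have "\<dots> = d" using ne by (simp add: d_def infdist_def)
    finally show False by (simp add: field_simps)
  qed
  then obtain y where y: "\<And>n. y n \<in> M" "\<And>n. norm (f - y n) < d + 1 / Suc n" by metis
  \<comment> \<open>The parallelogram law bounds the squared distance of \<open>y m\<close> and
    \<open>y n\<close> by twice both squared distances to \<open>f\<close> minus
    \<open>4 * d\<^sup>2\<close>. Splitting that last term evenly over the two indices gives
    \<open>a m + a n\<close>.\<close>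
  define a where "a n = 2 * ((d + 1 / Suc n)\<^sup>2 - d\<^sup>2)" for n
  have le: "(norm (y m - y n))\<^sup>2 \<le> a m + a n" for m n
  proof -
    have "(1/2) *\<^sub>R (y m + y n) \<in> M"
      using M(2) y(1) by (intro subspace_scale subspace_add) auto
    then have "d \<le> norm (f - (1/2) *\<^sub>R (y m + y n))" by (rule d(2))
    then have "2 * d \<le> norm (2 *\<^sub>R (f - (1/2) *\<^sub>R (y m + y n)))" by simp
    also have "2 *\<^sub>R (f - (1/2) *\<^sub>R (y m + y n)) = (f - y n) + (f - y m)"
      by (simp add: algebra_simps scaleR_2)
    finally have 1: "(2 * d)\<^sup>2 \<le> (norm ((f - y n) + (f - y m)))\<^sup>2"
      using d(1) by (intro power_mono) auto
    have 2: "(norm (f - y k))\<^sup>2 \<le> (d + 1 / Suc k)\<^sup>2" for k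
      using y(2)[of k] by (intro power_mono) auto
    show ?thesis
      using parallelogram_law[of "f - y n" "f - y m"] 1 2[of m] 2[of n]
      by (simp add: a_def power_mult_distrib)
  qed
  have a0: "a \<longlonglongrightarrow> 0"
  proof -
    have "a \<longlonglongrightarrow> 2 * ((d + 0)\<^sup>2 - d\<^sup>2)"
      unfolding a_def by (intro tendsto_intros LIMSEQ_Suc[OF lim_const_over_n])
    then show ?thesis by simp
  qed
  have "Cauchy y"
  proof (rule metric_CauchyI)
    fix e :: real assume "e > 0"
    then have "\<forall>\<^sub>F n in sequentially. a n < e\<^sup>2 / 2"
      by (intro order_tendstoD(2)[OF a0]) simp
    then obtain N where N: "\<And>n. n \<ge> N \<Longrightarrow> a n < e\<^sup>2 / 2"
      by (auto simp: eventually_sequentially)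
    have "dist (y m) (y n) < e" if "m \<ge> N" "n \<ge> N" for m n
    proof -
      have "(norm (y m - y n))\<^sup>2 < e\<^sup>2" using le[of m n] N[OF that(1)] N[OF that(2)] by simp
      then show ?thesis using \<open>e > 0\<close> power_less_imp_less_base by (fastforce simp: dist_norm)
    qed
    then show "\<exists>M. \<forall>m\<ge>M. \<forall>n\<ge>M. dist (y m) (y n) < e" by blast
  qed
  then obtain z where z: "y \<longlonglongrightarrow> z" by (auto simp: convergent_eq_Cauchy[symmetric])
  have "z \<in> M" using closed_sequentially[OF M(1)] y(1) z by blast
  moreover have "norm (f - z) \<le> d + 0"
  proof (rule tendsto_le[OF sequentially_bot])
    show "(\<lambda>n. d + 1 / Suc n) \<longlonglongrightarrow> d + 0"
      by (intro tendsto_intros LIMSEQ_Suc[OF lim_const_over_n])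
    show "(\<lambda>n. norm (f - y n)) \<longlonglongrightarrow> norm (f - z)" by (intro tendsto_intros z)
    show "\<forall>\<^sub>F n in sequentially. norm (f - y n) \<le> d + 1 / Suc n"
      using y(2) by (auto intro!: always_eventually less_imp_le)
  qed
  ultimately show thesis using d(2) that[of z] by (force simp: dist_norm)
qed

text \<open>If \<open>y\<close> is the point of \<open>M\<close> closest to \<open>f\<close>, then
  \<open>f - y\<close> is orthogonal to \<open>M\<close>, so the hypothesis forces
  \<open>f = y\<close>.\<close>

lemma closed_subspace_eq_UNIV:
  fixes M :: "'a::{real_inner, complete_space} set"
  assumes M: "closed M" "subspace M"
    and orth: "\<And>z. (\<And>x. x \<in> M \<Longrightarrow> x \<bullet> z = 0) \<Longrightarrow> z = 0"
  shows "M = UNIV"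
proof -
  have "f \<in> M" for f
  proof -
    obtain y where y: "y \<in> M" "\<And>x. x \<in> M \<Longrightarrow> dist f y \<le> dist f x"
      using closed_subspace_closest_point[OF M, of f] by blast
    have "x \<bullet> (f - y) = 0" if x: "x \<in> M" for x
    proof (cases "x = 0")
      case False
      \<comment> \<open>The coefficient of the projection of \<open>f - y\<close> onto
        \<open>x\<close>: moving \<open>y\<close> by \<open>t *\<^sub>R x\<close> would bring it
        strictly closer to \<open>f\<close> unless the inner product vanishes.\<close>
      define t where "t = (x \<bullet> (f - y)) / (x \<bullet> x)"
      have "y + t *\<^sub>R x \<in> M" using M(2) x y(1) by (intro subspace_add subspace_scale)
      then have "norm (f - y) \<le> norm (f - (y + t *\<^sub>R x))" using y(2) by (simp add: dist_norm)
      then have "(norm (f - y))\<^sup>2 \<le> (norm ((f - y) - t *\<^sub>R x))\<^sup>2"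
        by (intro power_mono) (simp_all add: diff_diff_eq)
      also have "\<dots> = (norm (f - y))\<^sup>2 - 2 * t * (x \<bullet> (f - y)) + t * (t * (x \<bullet> x))"
        by (simp add: power2_norm_eq_inner inner_diff_left inner_diff_right inner_commute algebra_simps)
      also have "t * (x \<bullet> x) = x \<bullet> (f - y)" using False by (simp add: t_def)
      finally have "t * (x \<bullet> (f - y)) \<le> 0" by simp
      then have "(x \<bullet> (f - y))\<^sup>2 / (x \<bullet> x) \<le> 0" by (simp add: t_def power2_eq_square)
      moreover have "x \<bullet> x > 0" using False by simp
      ultimately have "(x \<bullet> (f - y))\<^sup>2 \<le> 0" by (simp add: divide_le_0_iff)
      then show ?thesis by simp
    qed simp
    then have "f - y = 0" by (rule orth)
    then show ?thesis using y(1) by simp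
  qed
  then show ?thesis by blast
qed

section \<open>Nonnegative selfadjoint operators\<close>

locale nonneg_selfadjoint =
  fixes D :: "'a::{real_inner, complete_space} set" and L :: "'a \<Rightarrow> 'a"
  assumes linear_op: "linear_operator_on D L"
    and dense: "densely_defined D"
    and selfadjoint: "selfadjoint_operator D L"
    and nonneg: "nonneg_operator D L"
begin

section \<open>Algebra, symmetry and closedness of the operator\<close>

lemma subspace_D: "subspace D"
  and L_add: "x \<in> D \<Longrightarrow> y \<in> D \<Longrightarrow> L (x + y) = L x + L y"
  and L_scale: "x \<in> D \<Longrightarrow> L (c *\<^sub>R x) = c *\<^sub>R L x"
  using linear_op by (auto simp: linear_operator_on_def)

lemma L_diff: "x \<in> D \<Longrightarrow> y \<in> D \<Longrightarrow> L (x - y) = L x - L y"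
  using L_add[of x "(-1) *\<^sub>R y"] L_scale[of y "-1"] subspace_scale[OF subspace_D, of y "-1"] by simp

lemma L_0: "L 0 = 0"
  using L_scale[of 0 0] subspace_0[OF subspace_D] by simp

lemma L_nonneg: "x \<in> D \<Longrightarrow> 0 \<le> L x \<bullet> x"
  using nonneg by (auto simp: nonneg_operator_def)

text \<open>The working form of selfadjointness: a weak identity tested on \<open>D\<close> yields
  both membership in \<open>D\<close> and the value of \<open>L\<close>. Density makes
  \<open>z\<close> unique, since two candidates differ by a vector orthogonal to the closure of
  \<open>D\<close>; this determines the definite description in
  \<open>adjoint_operator\<close>.\<close>

lemma adjoint_memD:
  assumes adj: "\<And>x. x \<in> D \<Longrightarrow> L x \<bullet> y = x \<bullet> z"
  shows "y \<in> D" "L y = z"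
proof -
  have y: "y \<in> adjoint_domain D L" using adj by (auto simp: adjoint_domain_def)
  then show "y \<in> D" using selfadjoint by (auto simp: selfadjoint_operator_def)
  then have "L y = adjoint_operator D L y" using selfadjoint by (simp add: selfadjoint_operator_def)
  also have "\<dots> = z"
    unfolding adjoint_operator_def
  proof (rule the_equality)
    fix w assume w: "\<forall>x\<in>D. L x \<bullet> y = x \<bullet> w"
    have "closure D \<subseteq> {x. x \<bullet> (w - z) = 0}"
    proof (rule closure_minimal)
      show "D \<subseteq> {x. x \<bullet> (w - z) = 0}" using w adj by (auto simp: inner_diff_right)
      show "closed {x. x \<bullet> (w - z) = 0}"
        by (intro closed_Collect_eq continuous_intros)
    qed
    then have "w - z \<in> {x. x \<bullet> (w - z) = 0}" using dense unfolding densely_defined_def by blast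
    then show "w = z" by simp
  qed (use adj in auto)
  finally show "L y = z" .
qed

lemma symmetric:
  assumes "x \<in> D" "y \<in> D"
  shows "L x \<bullet> y = x \<bullet> L y"
proof -
  have "y \<in> adjoint_domain D L" using assms selfadjoint by (auto simp: selfadjoint_operator_def)
  then obtain z where z: "\<And>x. x \<in> D \<Longrightarrow> L x \<bullet> y = x \<bullet> z" by (auto simp: adjoint_domain_def)
  then show ?thesis using adjoint_memD(2)[OF z] assms by simp
qed

text \<open>Adjoints are closed: letting \<open>n\<close> tend to infinity in
  \<open>L y \<bullet> X n = y \<bullet> L (X n)\<close> leaves the weak identity that characterizes
  \<open>L x = z\<close>.\<close>

lemma closed_operator:
  assumes X: "\<And>n. X n \<in> D" "X \<longlonglongrightarrow> x" "(\<lambda>n. L (X n)) \<longlonglongrightarrow> z"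
  shows "x \<in> D" "L x = z"
proof -
  have "L y \<bullet> x = y \<bullet> z" if "y \<in> D" for y
  proof (rule LIMSEQ_unique)
    show "(\<lambda>n. L y \<bullet> X n) \<longlonglongrightarrow> L y \<bullet> x" by (intro tendsto_intros X)
    show "(\<lambda>n. L y \<bullet> X n) \<longlonglongrightarrow> y \<bullet> z"
      using symmetric[OF that X(1)] by (simp add: tendsto_inner[OF tendsto_const X(3)])
  qed
  then show "x \<in> D" "L x = z" using adjoint_memD[of x z] by blast+
qed

section \<open>The shifted operator and its bounded inverse\<close>

abbreviation shifted :: "real \<Rightarrow> 'a \<Rightarrow> 'a" where
  "shifted \<epsilon> x \<equiv> L x + \<epsilon> *\<^sub>R x"

lemma shifted_diff: "x \<in> D \<Longrightarrow> y \<in> D \<Longrightarrow> shifted \<epsilon> (x - y) = shifted \<epsilon> x - shifted \<epsilon> y"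
  by (simp add: L_diff algebra_simps)

lemma shifted_coercive: "x \<in> D \<Longrightarrow> \<epsilon> * (norm x)\<^sup>2 \<le> shifted \<epsilon> x \<bullet> x"
  using L_nonneg[of x] by (simp add: inner_add_left power2_norm_eq_inner)

text \<open>Coercivity and the Cauchy-Schwarz inequality. The vectors \<open>a\<close> and
  \<open>b\<close> stand for values at \<open>x\<close> and \<open>y\<close> of a monotone
  perturbation, so one estimate covers the zero perturbation, a scaled operator \<open>B\<close>,
  and \<open>g' u\<close>.\<close>

lemma shifted_add_monotone_expansive:
  assumes "x \<in> D" "y \<in> D" "\<epsilon> > 0" "0 \<le> (a - b) \<bullet> (x - y)"
  shows "\<epsilon> * norm (x - y) \<le> norm ((shifted \<epsilon> x + a) - (shifted \<epsilon> y + b))"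
proof (cases "x = y")
  case False
  have "x - y \<in> D" using assms subspace_diff[OF subspace_D] by blast
  then have "\<epsilon> * (norm (x - y))\<^sup>2 \<le> (shifted \<epsilon> x - shifted \<epsilon> y) \<bullet> (x - y)"
    using shifted_coercive[of "x - y" \<epsilon>] shifted_diff[OF assms(1,2)] by simp
  also have "\<dots> \<le> ((shifted \<epsilon> x + a) - (shifted \<epsilon> y + b)) \<bullet> (x - y)"
    using assms(4) by (simp add: inner_diff_left inner_add_left)
  also have "\<dots> \<le> norm ((shifted \<epsilon> x + a) - (shifted \<epsilon> y + b)) * norm (x - y)"
    by (rule norm_cauchy_schwarz)
  finally have "(\<epsilon> * norm (x - y)) * norm (x - y)
      \<le> norm ((shifted \<epsilon> x + a) - (shifted \<epsilon> y + b)) * norm (x - y)"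
    by (simp only: power2_eq_square mult.assoc)
  then show ?thesis using False by (simp only: mult_le_cancel_right) simp
qed simp

lemma shifted_expansive:
  assumes "x \<in> D" "y \<in> D" "\<epsilon> > 0"
  shows "\<epsilon> * norm (x - y) \<le> norm (shifted \<epsilon> x - shifted \<epsilon> y)"
  using shifted_add_monotone_expansive[OF assms, of 0 0] by simp

text \<open>The range is closed because the operator is expansive and \<open>L\<close> is closed. A
  vector \<open>y\<close> orthogonal to the range satisfies
  \<open>L y = - \<epsilon> *\<^sub>R y\<close>, which nonnegativity of \<open>L\<close> allows only
  for \<open>y = 0\<close>.\<close>

lemma shifted_surj:
  assumes \<epsilon>: "\<epsilon> > 0"
  shows "shifted \<epsilon> ` D = UNIV"
proof (rule closed_subspace_eq_UNIV)
  show "closed (shifted \<epsilon> ` D)"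
    unfolding closed_sequential_limits
  proof (intro allI impI, elim conjE)
    fix F f assume F: "\<forall>n. F n \<in> shifted \<epsilon> ` D" "F \<longlonglongrightarrow> f"
    then have "\<forall>n. \<exists>x. x \<in> D \<and> F n = shifted \<epsilon> x" by blast
    then obtain X where X: "\<And>n. X n \<in> D" "\<And>n. F n = shifted \<epsilon> (X n)"
      unfolding choice_iff by blast
    have "Cauchy X"
    proof (rule metric_CauchyI)
      fix e :: real assume "e > 0"
      then obtain N where "\<And>m n. m \<ge> N \<Longrightarrow> n \<ge> N \<Longrightarrow> dist (F m) (F n) < \<epsilon> * e"
        using metric_CauchyD[OF LIMSEQ_imp_Cauchy[OF F(2)], of "\<epsilon> * e"] \<epsilon> by auto
      then have "dist (X m) (X n) < e" if "m \<ge> N" "n \<ge> N" for m n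
        using shifted_expansive[OF X(1) X(1) \<epsilon>, of m n] that \<epsilon>
        by (simp only: dist_norm X(2)) (meson le_less_trans mult_less_cancel_left_pos)
      then show "\<exists>M. \<forall>m\<ge>M. \<forall>n\<ge>M. dist (X m) (X n) < e" by blast
    qed
    then obtain x where x: "X \<longlonglongrightarrow> x" by (auto simp: convergent_eq_Cauchy[symmetric])
    have "(\<lambda>n. F n - \<epsilon> *\<^sub>R X n) \<longlonglongrightarrow> f - \<epsilon> *\<^sub>R x" by (intro tendsto_intros F x)
    then have "(\<lambda>n. L (X n)) \<longlonglongrightarrow> f - \<epsilon> *\<^sub>R x" by (simp add: X(2))
    from closed_operator[OF X(1) x this] show "f \<in> shifted \<epsilon> ` D" by (force simp: image_iff)
  qed
  show "subspace (shifted \<epsilon> ` D)"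
  proof (rule subspaceI)
    show "0 \<in> shifted \<epsilon> ` D"
      using subspace_0[OF subspace_D] L_0 by (force simp: image_iff)
    fix u v assume "u \<in> shifted \<epsilon> ` D" "v \<in> shifted \<epsilon> ` D"
    then obtain x y where "x \<in> D" "y \<in> D" "u = shifted \<epsilon> x" "v = shifted \<epsilon> y" by auto
    then show "u + v \<in> shifted \<epsilon> ` D"
      by (intro image_eqI[of _ _ "x + y"])
        (auto simp: L_add scaleR_add_right subspace_add[OF subspace_D])
  next
    fix c u assume "u \<in> shifted \<epsilon> ` D"
    then obtain x where "x \<in> D" "u = shifted \<epsilon> x" by auto
    then show "c *\<^sub>R u \<in> shifted \<epsilon> ` D"
      by (intro image_eqI[of _ _ "c *\<^sub>R x"])
        (auto simp: L_scale scaleR_add_right subspace_scale[OF subspace_D])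
  qed
  fix y assume orth: "\<And>w. w \<in> shifted \<epsilon> ` D \<Longrightarrow> w \<bullet> y = 0"
  have adj: "L x \<bullet> y = x \<bullet> (- \<epsilon> *\<^sub>R y)" if "x \<in> D" for x
    using orth[of "shifted \<epsilon> x"] that by (simp add: inner_add_left)
  have "0 \<le> L y \<bullet> y" by (intro L_nonneg adjoint_memD(1)[OF adj])
  then have "\<epsilon> * (y \<bullet> y) \<le> 0" using adjoint_memD(2)[OF adj] by simp
  then have "y \<bullet> y \<le> 0" using \<epsilon> by (simp add: mult_le_0_iff)
  then show "y = 0" by (meson inner_gt_zero_iff not_less)
qed

lemma shifted_bij: "\<epsilon> > 0 \<Longrightarrow> bij_betw (shifted \<epsilon>) D UNIV"
proof (rule bij_betw_imageI)
  assume \<epsilon>: "\<epsilon> > 0"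
  show "inj_on (shifted \<epsilon>) D"
  proof (rule inj_onI)
    fix x y assume "x \<in> D" "y \<in> D" "shifted \<epsilon> x = shifted \<epsilon> y"
    then have "\<epsilon> * norm (x - y) \<le> 0" using shifted_expansive[of x y \<epsilon>] \<epsilon> by simp
    then show "x = y" using \<epsilon> by (simp add: mult_le_0_iff)
  qed
qed (rule shifted_surj)

lemma shifted_inverse_eq_iff:
  assumes "\<epsilon> > 0"
  shows "shifted_inverse D L \<epsilon> f = x \<longleftrightarrow> x \<in> D \<and> shifted \<epsilon> x = f"
  unfolding shifted_inverse_def
  using bij_betw_inv_into_left[OF shifted_bij[OF assms]]
    bij_betw_inv_into_right[OF shifted_bij[OF assms], of f]
    bij_betw_apply[OF bij_betw_inv_into[OF shifted_bij[OF assms]], of f] by auto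

lemma norm_shifted_inverse_le:
  assumes \<epsilon>: "\<epsilon> > 0"
  shows "norm (shifted_inverse D L \<epsilon> f) \<le> norm f / \<epsilon>"
  using shifted_expansive[of "shifted_inverse D L \<epsilon> f" 0, OF _ subspace_0[OF subspace_D] \<epsilon>]
    shifted_inverse_eq_iff[OF \<epsilon>, of f "shifted_inverse D L \<epsilon> f"] L_0 \<epsilon>
  by (simp add: field_simps)

lemma bounded_linear_shifted_inverse:
  assumes \<epsilon>: "\<epsilon> > 0"
  shows "bounded_linear (shifted_inverse D L \<epsilon>)"
proof (rule bounded_linear_intro)
  let ?A = "shifted_inverse D L \<epsilon>"
  have A: "?A f \<in> D" "shifted \<epsilon> (?A f) = f" for f
    using shifted_inverse_eq_iff[OF \<epsilon>, of f] by auto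
  show "?A (f + h) = ?A f + ?A h" for f h
  proof -
    have "shifted \<epsilon> (?A f + ?A h) = shifted \<epsilon> (?A f) + shifted \<epsilon> (?A h)"
      by (simp only: L_add[OF A(1) A(1)] scaleR_add_right ac_simps)
    then show ?thesis
      unfolding shifted_inverse_eq_iff[OF \<epsilon>] A(2) by (simp add: A(1) subspace_add[OF subspace_D])
  qed
  show "?A (c *\<^sub>R f) = c *\<^sub>R ?A f" for c f
  proof -
    have "shifted \<epsilon> (c *\<^sub>R ?A f) = c *\<^sub>R shifted \<epsilon> (?A f)"
      by (simp only: L_scale[OF A(1)] scaleR_add_right scaleR_left_commute)
    then show ?thesis
      unfolding shifted_inverse_eq_iff[OF \<epsilon>] A(2) by (simp add: A(1) subspace_scale[OF subspace_D])
  qed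
  show "norm (?A f) \<le> norm f * (1 / \<epsilon>)" for f
    using norm_shifted_inverse_le[OF \<epsilon>, of f] by simp
qed

text \<open>
  Method of continuity: \<open>L + \<epsilon> I + s B\<close> stays \<open>\<epsilon>\<close>-expansive for all \<open>s \<ge> 0\<close>, so surjectivity
  propagates from \<open>s\<close> to \<open>s + \<delta>\<close> with a step \<open>\<delta>\<close> independent of \<open>s\<close>.
\<close>

lemma shifted_add_surj:
  fixes B :: "'a \<Rightarrow>\<^sub>L 'a"
  assumes \<epsilon>: "\<epsilon> > 0" and B: "\<And>h. 0 \<le> B h \<bullet> h"
  shows "\<exists>x\<in>D. shifted \<epsilon> x + B x = f"
proof -
  \<comment> \<open>With steps of size \<open>1 / N\<close> the contraction constant below is
    \<open>norm B / (N * \<epsilon>) < 1\<close>; after \<open>N\<close> steps the full operator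
    \<open>B\<close> is reached.\<close>
  obtain N :: nat where N: "norm B < real N * \<epsilon>" "N > 0"
  proof -
    obtain N :: nat where "norm B / \<epsilon> < real N" using reals_Archimedean2 by blast
    moreover have "N > 0"
      using le_less_trans[OF divide_nonneg_pos[OF norm_ge_zero \<epsilon>] \<open>norm B / \<epsilon> < real N\<close>] by simp
    ultimately show thesis using \<epsilon> that by (simp add: field_simps)
  qed
  have "\<exists>x\<in>D. shifted \<epsilon> x + (real n / real N) *\<^sub>R B x = f" for n :: nat and f
  proof (induction n arbitrary: f)
    case 0
    have "f \<in> shifted \<epsilon> ` D" using shifted_surj[OF \<epsilon>] by blast
    then show ?case by auto
  next
    case (Suc n)
    define s where "s = real n / real N"
    obtain r where r: "\<And>f. r f \<in> D" "\<And>f. shifted \<epsilon> (r f) + s *\<^sub>R B (r f) = f"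
      using Suc unfolding s_def by metis
    have lip: "\<epsilon> * norm (r p - r q) \<le> norm (p - q)" for p q
    proof -
      have "0 \<le> (s *\<^sub>R B (r p) - s *\<^sub>R B (r q)) \<bullet> (r p - r q)"
        using B[of "r p - r q"] by (simp add: s_def blinfun.diff_right flip: scaleR_diff_right)
      from shifted_add_monotone_expansive[OF r(1) r(1) \<epsilon> this] show ?thesis by (simp only: r(2))
    qed
    \<comment> \<open>With \<open>r\<close> the solution operator at level \<open>s\<close>, fixed
      points of \<open>\<phi>\<close> are exactly the solutions at level \<open>s + 1 / N\<close>:
      the extra portion of \<open>B x\<close> has been moved to the right-hand side.\<close>
    define \<phi> where "\<phi> x = r (f - (1 / real N) *\<^sub>R B x)" for x
    have "\<exists>!x. \<phi> x = x"
    proof (rule banach_fix_type)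
      show "0 \<le> norm B / (N * \<epsilon>)" using \<epsilon> by simp
      show "norm B / (N * \<epsilon>) < 1" using N \<epsilon> by simp
      have "dist (\<phi> x) (\<phi> y) \<le> norm B / (N * \<epsilon>) * dist x y" for x y
      proof -
        have "\<epsilon> * norm (\<phi> x - \<phi> y) \<le> norm ((f - (1 / real N) *\<^sub>R B x) - (f - (1 / real N) *\<^sub>R B y))"
          unfolding \<phi>_def by (rule lip)
        also have "\<dots> = norm (B (x - y)) / N"
          by (simp add: blinfun.diff_right norm_minus_commute flip: scaleR_diff_right)
        also have "\<dots> \<le> norm B * norm (x - y) / N"
          by (intro divide_right_mono norm_blinfun) simp
        finally show ?thesis using \<epsilon> N by (simp add: dist_norm field_simps)
      qed
      then show "\<forall>x y. dist (\<phi> x) (\<phi> y) \<le> norm B / (N * \<epsilon>) * dist x y" by blast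
    qed
    then obtain x where x: "r (f - (1 / real N) *\<^sub>R B x) = x" by (auto simp: \<phi>_def)
    have "shifted \<epsilon> x + s *\<^sub>R B x = f - (1 / real N) *\<^sub>R B x"
      using r(2)[of "f - (1 / real N) *\<^sub>R B x"] by (simp only: x)
    moreover have "real (Suc n) / real N = s + 1 / real N" by (simp add: s_def add_divide_distrib)
    ultimately have "shifted \<epsilon> x + (real (Suc n) / real N) *\<^sub>R B x = f"
      by (simp add: scaleR_add_left algebra_simps)
    then show ?case using r(1)[of "f - (1 / real N) *\<^sub>R B x"] x by (intro bexI[of _ x]) auto
  qed
  from this[of N f] show ?thesis using N(2) by simp
qed

end

section \<open>Regularized equations with a monotone nonlinearity\<close>

locale monotone_equation = nonneg_selfadjoint D L
  for D :: "'a::{real_inner, complete_space} set" and L :: "'a \<Rightarrow> 'a" +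
  fixes g :: "'a \<Rightarrow> 'a" and g' :: "'a \<Rightarrow> 'a \<Rightarrow>\<^sub>L 'a"
  assumes g_has_derivative: "(g has_derivative blinfun_apply (g' u)) (at u)"
    and isCont_g': "isCont g' u"
    and g'_nonneg: "0 \<le> g' u h \<bullet> h"
begin

lemma isCont_g: "isCont g u"
  using has_derivative_continuous[OF g_has_derivative] by simp

text \<open>Along the segment from \<open>y\<close> to \<open>x\<close>, the pairing of
  \<open>g\<close> with \<open>x - y\<close> has derivative
  \<open>g' (...) (x - y) \<bullet> (x - y)\<close>, which is nonnegative.\<close>

lemma g_monotone: "0 \<le> (g x - g y) \<bullet> (x - y)"
proof -
  let ?l = "\<lambda>t::real. y + t *\<^sub>R (x - y)"
  have "g (?l 0) \<bullet> (x - y) \<le> g (?l 1) \<bullet> (x - y)"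
  proof (rule DERIV_nonneg_imp_nondecreasing[of 0 1 "\<lambda>t. g (?l t) \<bullet> (x - y)"])
    fix t :: real
    have "(?l has_derivative (\<lambda>s. s *\<^sub>R (x - y))) (at t)"
      by (auto intro!: derivative_eq_intros)
    then have "((\<lambda>t. g (?l t)) has_derivative (\<lambda>s. g' (?l t) (s *\<^sub>R (x - y)))) (at t)"
      by (rule has_derivative_compose) (rule g_has_derivative)
    then have "((\<lambda>t. g (?l t) \<bullet> (x - y)) has_derivative (\<lambda>s. g' (?l t) (s *\<^sub>R (x - y)) \<bullet> (x - y))) (at t)"
      by (rule has_derivative_inner_left)
    then have "((\<lambda>t. g (?l t) \<bullet> (x - y)) has_field_derivative g' (?l t) (x - y) \<bullet> (x - y)) (at t)"
      unfolding has_field_derivative_def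
      by (rule has_derivative_eq_rhs) (simp add: blinfun.scaleR_right fun_eq_iff)
    then show "\<exists>d. ((\<lambda>t. g (?l t) \<bullet> (x - y)) has_field_derivative d) (at t) \<and> 0 \<le> d"
      using g'_nonneg by blast
  qed simp
  then show ?thesis by (simp add: inner_diff_left)
qed

text \<open>On \<open>D\<close> this is the inverse of the shifted operator applied to
  \<open>shifted \<epsilon> u + g u\<close>. Unlike that sum it is defined and continuous on the
  whole space, and its zeros are the solutions of the regularized equation.\<close>

definition reg :: "real \<Rightarrow> 'a \<Rightarrow> 'a" where
  "reg \<epsilon> u = u + shifted_inverse D L \<epsilon> (g u)"

text \<open>Eliminates the inverse operator. Only the difference \<open>p - u\<close> has to lie in
  \<open>D\<close>, while \<open>u\<close> is arbitrary, so coercivity is always applied to such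
  differences.\<close>

lemma reg_eq_iff: "\<epsilon> > 0 \<Longrightarrow> reg \<epsilon> u = p \<longleftrightarrow> p - u \<in> D \<and> shifted \<epsilon> (p - u) = g u"
  unfolding shifted_inverse_eq_iff[symmetric] reg_def by (auto simp: algebra_simps)

lemma reg_coercive:
  assumes \<epsilon>: "\<epsilon> > 0"
  shows "\<epsilon> * (norm ((reg \<epsilon> u - reg \<epsilon> w) - (u - w)))\<^sup>2
    \<le> (g u - g w) \<bullet> ((reg \<epsilon> u - reg \<epsilon> w) - (u - w))"
proof -
  let ?i = "reg \<epsilon> u - u" and ?j = "reg \<epsilon> w - w"
  have "?i \<in> D" "shifted \<epsilon> ?i = g u" "?j \<in> D" "shifted \<epsilon> ?j = g w"
    using reg_eq_iff[OF \<epsilon>] by blast+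
  then have "\<epsilon> * (norm (?i - ?j))\<^sup>2 \<le> (g u - g w) \<bullet> (?i - ?j)"
    using shifted_coercive[of "?i - ?j" \<epsilon>] shifted_diff[of ?i ?j \<epsilon>] subspace_diff[OF subspace_D]
    by simp
  then show ?thesis by (simp add: algebra_simps)
qed

text \<open>Coercivity bounds the defect \<open>d = u - x\<close>, where \<open>x\<close> is
  \<open>w\<close> shifted by the difference of the images. Monotonicity between \<open>u\<close>
  and \<open>x\<close> replaces the uncontrolled \<open>g u\<close> by \<open>g x\<close>. The bound
  then involves only the variation of \<open>g\<close> near \<open>w\<close>, which yields
  injectivity and continuity of the inverse.\<close>

lemma reg_inverse_estimate:
  assumes \<epsilon>: "\<epsilon> > 0"
  shows "\<epsilon> * norm ((u - w) - (reg \<epsilon> u - reg \<epsilon> w)) \<le> norm (g (w + (reg \<epsilon> u - reg \<epsilon> w)) - g w)"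
proof -
  define d where "d = (u - w) - (reg \<epsilon> u - reg \<epsilon> w)"
  define x where "x = w + (reg \<epsilon> u - reg \<epsilon> w)"
  have d: "d = u - x" "(reg \<epsilon> u - reg \<epsilon> w) - (u - w) = - d" by (simp_all add: d_def x_def)
  have "\<epsilon> * (norm d)\<^sup>2 \<le> - ((g u - g w) \<bullet> d)"
    using reg_coercive[OF \<epsilon>, of u w] unfolding d(2) by simp
  also have "\<dots> \<le> - ((g x - g w) \<bullet> d)"
    using g_monotone[of u x] by (simp add: d(1)[symmetric] inner_diff_left)
  also have "\<dots> \<le> norm (g x - g w) * norm d"
    using norm_cauchy_schwarz[of "- (g x - g w)" d] by (simp only: inner_minus_left norm_minus_cancel)
  finally have "(\<epsilon> * norm d) * norm d \<le> norm (g x - g w) * norm d"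
    by (simp only: power2_eq_square mult.assoc)
  then show ?thesis
    by (cases "d = 0") (simp_all only: mult_le_cancel_right d_def[symmetric] x_def[symmetric], simp_all)
qed

lemma inj_reg: "\<epsilon> > 0 \<Longrightarrow> inj (reg \<epsilon>)"
proof (rule injI)
  fix u w assume "\<epsilon> > 0" "reg \<epsilon> u = reg \<epsilon> w"
  then show "u = w" using reg_inverse_estimate[of \<epsilon> u w] by (simp add: mult_le_0_iff)
qed

text \<open>
  A continuous monotone map need not be bounded on bounded sets; the bound at \<open>u\<close> comes from
  testing monotonicity against every point of the ball around \<open>reg \<epsilon> u\<close>.
\<close>

lemma norm_g_le:
  assumes \<epsilon>: "\<epsilon> > 0" and r: "r > 0"
    and M: "\<And>x. x \<in> cball (reg \<epsilon> u) r \<Longrightarrow> norm (g x) \<le> M"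
  shows "norm (g u) \<le> M * (M / \<epsilon> + r) / r"
proof (cases "g u = 0")
  case True
  have "0 \<le> M" using M[of "reg \<epsilon> u"] r norm_ge_zero[of "g (reg \<epsilon> u)"] by (simp del: norm_ge_zero)
  then show ?thesis using True \<epsilon> r by simp
next
  case False
  define p j where "p = reg \<epsilon> u" and "j = reg \<epsilon> u - u"
  have j: "j \<in> D" "shifted \<epsilon> j = g u" "u = p - j"
    using reg_eq_iff[OF \<epsilon>, of u p] by (auto simp: p_def j_def)
  have Mp: "norm (g p) \<le> M" using M[of p] r by (simp add: p_def)
  then have M0: "0 \<le> M" by (rule order_trans[OF norm_ge_zero])
  \<comment> \<open>Pairing \<open>u\<close> with the centre \<open>p\<close> of the ball gives
    \<open>g u \<bullet> j \<le> g p \<bullet> j\<close>, hence an a priori bound on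
    \<open>j\<close>.\<close>
  have 1: "\<epsilon> * (norm j)\<^sup>2 \<le> g u \<bullet> j" using shifted_coercive[OF j(1), of \<epsilon>] j(2) by simp
  also have "\<dots> \<le> g p \<bullet> j"
    using g_monotone[of u p] by (simp add: j(3) inner_diff_left)
  also have "\<dots> \<le> norm (g p) * norm j" by (rule norm_cauchy_schwarz)
  also have "\<dots> \<le> M * norm j" using Mp by (intro mult_right_mono) auto
  finally have "(\<epsilon> * norm j) * norm j \<le> M * norm j" by (simp only: power2_eq_square mult.assoc)
  then have "\<epsilon> * norm j \<le> M"
    using M0 by (cases "j = 0") (simp_all only: mult_le_cancel_right, simp_all)
  then have nj: "norm j \<le> M / \<epsilon>" using \<epsilon> by (simp add: field_simps)
  \<comment> \<open>Of length \<open>r\<close> and pointing along \<open>g u\<close>: the test point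
    \<open>p + z\<close> stays in the ball, and the pairing with \<open>z\<close> recovers the full
    norm of \<open>g u\<close>.\<close>
  define z where "z = (r / norm (g u)) *\<^sub>R g u"
  have z: "norm z = r" "g u \<bullet> z = r * norm (g u)"
    using False r by (simp_all add: z_def flip: power2_norm_eq_inner) (simp add: power2_eq_square)
  have "u - (p + z) = - (j + z)" unfolding j(3) by simp
  then have "0 \<le> (g u - g (p + z)) \<bullet> (- (j + z))" by (metis g_monotone)
  then have "r * norm (g u) \<le> - (g u \<bullet> j) + g (p + z) \<bullet> (j + z)"
    unfolding z(2)[symmetric] by (simp add: inner_simps)
  also have "\<dots> \<le> g (p + z) \<bullet> (j + z)"
    using 1 \<epsilon> order_trans[of 0 "\<epsilon> * (norm j)\<^sup>2" "g u \<bullet> j"] by simp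
  also have "\<dots> \<le> norm (g (p + z)) * norm (j + z)" by (rule norm_cauchy_schwarz)
  also have "\<dots> \<le> M * (M / \<epsilon> + r)"
  proof (rule mult_mono)
    show "norm (g (p + z)) \<le> M" using M[of "p + z"] z(1) by (simp add: p_def dist_norm)
    show "norm (j + z) \<le> M / \<epsilon> + r" using norm_triangle_ineq[of j z] nj z(1) by simp
  qed (use M0 in auto)
  finally show ?thesis using r by (simp add: field_simps)
qed

text \<open>Continuity bounds \<open>g\<close> near the limit \<open>p\<close>, and
  \<open>norm_g_le\<close> carries the bound over to \<open>g\<close> at the preimages. Monotonicity
  then makes the differences between images and preimages Cauchy, so the preimages converge.\<close>

lemma closed_range_reg:
  assumes \<epsilon>: "\<epsilon> > 0"
  shows "closed (range (reg \<epsilon>))"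
  unfolding closed_sequential_limits
proof (intro allI impI, elim conjE)
  fix P p assume P: "\<forall>n. P n \<in> range (reg \<epsilon>)" "P \<longlonglongrightarrow> p"
  then have "\<forall>n. \<exists>u. P n = reg \<epsilon> u" by blast
  then obtain U where U: "\<And>n. P n = reg \<epsilon> (U n)" unfolding choice_iff by blast
  obtain r where r: "r > 0" "\<And>x. dist x p < r \<Longrightarrow> dist (g x) (g p) < 1"
    using isCont_g[of p] unfolding continuous_at_eps_delta by (metis zero_less_one)
  define M where "M = norm (g p) + 1"
  have M: "norm (g x) \<le> M" if "dist x p < r" for x
    using r(2)[OF that] norm_triangle_ineq2[of "g x" "g p"] by (simp add: M_def dist_norm)
  obtain N where N: "\<And>n. n \<ge> N \<Longrightarrow> dist (P n) p < r / 2"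
    using metric_LIMSEQ_D[OF P(2), of "r / 2"] r(1) by auto
  \<comment> \<open>Half the radius: for \<open>n \<ge> N\<close> the closed ball of radius
    \<open>r / 2\<close> around \<open>P n\<close> lies in the open ball of radius \<open>r\<close>
    around \<open>p\<close>, where \<open>M\<close> bounds \<open>g\<close>.\<close>
  define C where "C = M * (M / \<epsilon> + r / 2) / (r / 2)"
  have C: "norm (g (U n)) \<le> C" if "n \<ge> N" for n
    unfolding C_def
  proof (rule norm_g_le[OF \<epsilon>])
    show "r / 2 > 0" using r by simp
    show "norm (g x) \<le> M" if "x \<in> cball (reg \<epsilon> (U n)) (r / 2)" for x
      using that N[OF \<open>n \<ge> N\<close>] dist_triangle[of x p "P n"] by (intro M) (simp add: U dist_commute)
  qed
  define V Q where "V n = U (n + N)" and "Q n = P (n + N)" for n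
  have Q: "Q \<longlonglongrightarrow> p" unfolding Q_def by (rule LIMSEQ_ignore_initial_segment[OF P(2)])
  have VQ: "(dist (Q m - V m) (Q n - V n))\<^sup>2 \<le> (2 * C / \<epsilon>) * dist (Q m) (Q n)" for m n
  proof -
    have "\<epsilon> * (norm ((Q m - Q n) - (V m - V n)))\<^sup>2 \<le> (g (V m) - g (V n)) \<bullet> ((Q m - Q n) - (V m - V n))"
      using reg_coercive[OF \<epsilon>, of "V m" "V n"] by (simp add: Q_def V_def U)
    \<comment> \<open>Monotonicity discards the pairing with \<open>V m - V n\<close>, leaving a
      bound linear in the distance of the images.\<close>
    also have "\<dots> \<le> (g (V m) - g (V n)) \<bullet> (Q m - Q n)"
      using g_monotone[of "V m" "V n"] by (simp only: inner_diff_right[of _ "Q m - Q n"])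
    also have "\<dots> \<le> norm (g (V m) - g (V n)) * norm (Q m - Q n)" by (rule norm_cauchy_schwarz)
    also have "\<dots> \<le> (2 * C) * norm (Q m - Q n)"
      using norm_triangle_ineq4[of "g (V m)" "g (V n)"] C[of "m + N"] C[of "n + N"]
      by (intro mult_right_mono) (auto simp: V_def)
    finally have "(norm ((Q m - Q n) - (V m - V n)))\<^sup>2 \<le> (2 * C / \<epsilon>) * norm (Q m - Q n)"
      using \<epsilon> by (simp add: field_simps)
    moreover have "(Q m - Q n) - (V m - V n) = (Q m - V m) - (Q n - V n)" by simp
    ultimately show ?thesis by (simp only: dist_norm)
  qed
  have "Cauchy (\<lambda>n. Q n - V n)"
    by (rule Cauchy_if_dist_power2_le[OF LIMSEQ_imp_Cauchy[OF Q] VQ])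
  then obtain k where "(\<lambda>n. Q n - V n) \<longlonglongrightarrow> k" by (auto simp: convergent_eq_Cauchy[symmetric])
  from tendsto_diff[OF Q this] have V: "V \<longlonglongrightarrow> p - k" by simp
  have "(\<lambda>n. reg \<epsilon> (V n)) \<longlonglongrightarrow> reg \<epsilon> (p - k)"
    unfolding reg_def
    by (intro tendsto_add V bounded_linear.tendsto[OF bounded_linear_shifted_inverse[OF \<epsilon>]]
        isCont_tendsto_compose[OF isCont_g])
  moreover have "(\<lambda>n. reg \<epsilon> (V n)) = Q" by (simp add: fun_eq_iff Q_def V_def U)
  ultimately have "p = reg \<epsilon> (p - k)" using LIMSEQ_unique Q by blast
  then show "p \<in> range (reg \<epsilon>)" by blast
qed

section \<open>The linearization and local surjectivity\<close>

lemma bounded_linear_newton_operator: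
  "\<epsilon> > 0 \<Longrightarrow> bounded_linear (newton_operator D L g' \<epsilon> u)"
  unfolding newton_operator_def
  by (intro bounded_linear_add bounded_linear_ident blinfun.bounded_linear_right
      bounded_linear_compose[OF bounded_linear_shifted_inverse])

lemma reg_has_derivative:
  assumes \<epsilon>: "\<epsilon> > 0"
  shows "(reg \<epsilon> has_derivative newton_operator D L g' \<epsilon> u) (at u within S)"
  unfolding reg_def newton_operator_def
  by (intro has_derivative_add has_derivative_ident has_derivative_at_withinI[OF g_has_derivative]
      bounded_linear.has_derivative[OF bounded_linear_shifted_inverse[OF \<epsilon>]])

text \<open>For \<open>h\<close> in the kernel, \<open>- h\<close> solves the shifted equation with
  right-hand side \<open>g' u h\<close>; coercivity and \<open>g' u \<ge> 0\<close> then have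
  opposite signs.\<close>

lemma inj_newton_operator:
  assumes \<epsilon>: "\<epsilon> > 0"
  shows "inj (newton_operator D L g' \<epsilon> u)"
proof -
  interpret N: bounded_linear "newton_operator D L g' \<epsilon> u"
    by (rule bounded_linear_newton_operator[OF \<epsilon>])
  have "h = 0" if "newton_operator D L g' \<epsilon> u h = 0" for h
  proof -
    have "shifted_inverse D L \<epsilon> (g' u h) = - h"
      using that by (simp add: newton_operator_def eq_neg_iff_add_eq_0 add.commute)
    then have "- h \<in> D" "shifted \<epsilon> (- h) = g' u h" by (simp_all only: shifted_inverse_eq_iff[OF \<epsilon>])
    then have "\<epsilon> * (norm h)\<^sup>2 \<le> - (g' u h \<bullet> h)" using shifted_coercive[of "- h" \<epsilon>] by simp
    also have "\<dots> \<le> 0" using g'_nonneg[of u h] by simp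
    finally show ?thesis using \<epsilon> by (simp add: mult_le_0_iff)
  qed
  then show ?thesis by (simp add: linear_injective_0 N.linear_axioms)
qed

text \<open>The substitution \<open>h = f + k\<close> turns the equation into
  \<open>shifted \<epsilon> k + g' u k = - g' u f\<close>, which \<open>shifted_add_surj\<close>
  solves; expansiveness bounds \<open>k\<close>.\<close>

lemma newton_operator_solvable:
  assumes \<epsilon>: "\<epsilon> > 0"
  obtains h where "newton_operator D L g' \<epsilon> u h = f" "norm h \<le> norm f * (1 + norm (g' u) / \<epsilon>)"
proof -
  obtain k where k: "k \<in> D" "shifted \<epsilon> k + g' u k = - g' u f"
    using shifted_add_surj[OF \<epsilon> g'_nonneg] by blast
  have "shifted \<epsilon> (0 - k) = g' u (f + k)"
    unfolding shifted_diff[OF subspace_0[OF subspace_D] k(1)]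
    using arg_cong[OF k(2), of uminus] by (simp add: L_0 blinfun.add_right algebra_simps)
  then have "shifted_inverse D L \<epsilon> (g' u (f + k)) = - k"
    using k(1) subspace_neg[OF subspace_D] by (simp add: shifted_inverse_eq_iff[OF \<epsilon>])
  then have 1: "newton_operator D L g' \<epsilon> u (f + k) = f" by (simp add: newton_operator_def)
  have "\<epsilon> * norm (k - 0) \<le> norm ((shifted \<epsilon> k + g' u k) - (shifted \<epsilon> 0 + g' u 0))"
    using g'_nonneg[of u k]
    by (intro shifted_add_monotone_expansive k \<epsilon> subspace_0[OF subspace_D]) simp
  also have "\<dots> = norm (g' u f)" unfolding k(2) by (simp add: L_0)
  also have "\<dots> \<le> norm (g' u) * norm f" by (rule norm_blinfun)
  finally have "norm k \<le> norm f * (norm (g' u) / \<epsilon>)" using \<epsilon> by (simp add: field_simps)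
  then have "norm (f + k) \<le> norm f * (1 + norm (g' u) / \<epsilon>)"
    using norm_triangle_ineq[of f k] by (simp add: distrib_left)
  then show thesis by (rule that[OF 1])
qed

lemma bij_newton_operator: "\<epsilon> > 0 \<Longrightarrow> bij (newton_operator D L g' \<epsilon> u)"
  unfolding bij_def surj_def using inj_newton_operator newton_operator_solvable by metis

lemma bounded_linear_inv_newton_operator:
  assumes \<epsilon>: "\<epsilon> > 0"
  shows "bounded_linear (inv (newton_operator D L g' \<epsilon> u))"
proof (rule bounded_linear_intro)
  let ?N = "newton_operator D L g' \<epsilon> u"
  interpret N: bounded_linear ?N by (rule bounded_linear_newton_operator[OF \<epsilon>])
  have N: "?N (inv ?N f) = f" "inv ?N (?N f) = f" for f
    using bij_newton_operator[OF \<epsilon>, of u] by (simp_all add: bij_def surj_f_inv_f)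
  show "inv ?N (x + y) = inv ?N x + inv ?N y" for x y
    using N(2)[of "inv ?N x + inv ?N y"] by (simp add: N.add N(1))
  show "inv ?N (c *\<^sub>R x) = c *\<^sub>R inv ?N x" for c x
    using N(2)[of "c *\<^sub>R inv ?N x"] by (simp add: N.scaleR N(1))
  show "norm (inv ?N f) \<le> norm f * (1 + norm (g' u) / \<epsilon>)" for f
    using newton_operator_solvable[OF \<epsilon>, of u f] N(2) by metis
qed

text \<open>A Newton iteration with the derivative frozen at \<open>w\<close> is a contraction of a
  small ball around \<open>w\<close>, and its fixed point is a preimage of the prescribed nearby
  value \<open>p\<close>.\<close>

lemma open_range_reg:
  assumes \<epsilon>: "\<epsilon> > 0"
  shows "open (range (reg \<epsilon>))"
  unfolding open_contains_cball
proof
  fix q assume "q \<in> range (reg \<epsilon>)"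
  then obtain w where w: "q = reg \<epsilon> w" by blast
  define N Q where "N u = newton_operator D L g' \<epsilon> u" and "Q = inv (N w)" for u
  interpret Q: bounded_linear Q
    unfolding Q_def N_def by (rule bounded_linear_inv_newton_operator[OF \<epsilon>])
  have QN: "Q (N w h) = h" and NQ: "N w (Q h) = h" for h
    using bij_newton_operator[OF \<epsilon>, of w] by (simp_all add: Q_def N_def bij_def surj_f_inv_f)
  obtain C where C: "C > 0" "\<And>x. norm (Q x) \<le> norm x * C" using Q.pos_bounded by blast
  \<comment> \<open>This tolerance for \<open>g'\<close>, multiplied by the bound
    \<open>1 / \<epsilon>\<close> of the shifted inverse and the bound \<open>C\<close> of
    \<open>Q\<close>, gives the contraction constant \<open>1/2\<close>.\<close>
  have "\<epsilon> / (2 * C) > 0" using \<epsilon> C by simp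
  then obtain r where r: "r > 0" "\<And>u. dist u w < r \<Longrightarrow> dist (g' u) (g' w) < \<epsilon> / (2 * C)"
    using isCont_g'[of w] unfolding continuous_at_eps_delta by metis
  define \<rho> where "\<rho> = r / 2"
  have \<rho>: "\<rho> > 0" using r(1) by (simp add: \<rho>_def)
  have g'_close: "norm (g' w - g' u) \<le> \<epsilon> / (2 * C)" if "u \<in> cball w \<rho>" for u
    using r(1) r(2)[of u] that by (simp_all add: \<rho>_def dist_norm norm_minus_commute less_imp_le)
  \<comment> \<open>For such \<open>p\<close> the centre \<open>w\<close> is moved by at most
    \<open>\<rho> / 2\<close>; contraction contributes at most another \<open>\<rho> / 2\<close>, so
    the ball is mapped into itself.\<close>
  have "p \<in> range (reg \<epsilon>)" if p: "p \<in> cball q (\<rho> / (2 * C))" for p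
  proof -
    define \<phi> where "\<phi> u = u - Q (reg \<epsilon> u - p)" for u
    have lip: "norm (\<phi> x - \<phi> y) \<le> (1/2) * norm (x - y)" if "x \<in> cball w \<rho>" "y \<in> cball w \<rho>" for x y
    proof (rule differentiable_bound[OF convex_cball _ _ that])
      fix u assume u: "u \<in> cball w \<rho>"
      have "((\<lambda>u. reg \<epsilon> u - p) has_derivative (\<lambda>h. N u h - 0)) (at u within cball w \<rho>)"
        unfolding N_def by (intro has_derivative_diff reg_has_derivative \<epsilon> has_derivative_const)
      then show "(\<phi> has_derivative (\<lambda>h. h - Q (N u h - 0))) (at u within cball w \<rho>)"
        unfolding \<phi>_def by (rule has_derivative_diff[OF has_derivative_ident Q.has_derivative])
      show "onorm (\<lambda>h. h - Q (N u h - 0)) \<le> 1/2"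
      proof (rule onorm_bound)
        fix h
        have "N w h - N u h = shifted_inverse D L \<epsilon> ((g' w - g' u) h)"
          unfolding N_def newton_operator_def
          by (simp add: blinfun.diff_left linear_diff
              bounded_linear.linear[OF bounded_linear_shifted_inverse[OF \<epsilon>]])
        moreover have "h - Q (N u h - 0) = Q (N w h - N u h)" by (simp add: Q.diff QN)
        ultimately have "norm (h - Q (N u h - 0)) \<le> norm (shifted_inverse D L \<epsilon> ((g' w - g' u) h)) * C"
          using C(2) by simp
        also have "\<dots> \<le> (norm ((g' w - g' u) h) / \<epsilon>) * C"
          using C(1) by (intro mult_right_mono norm_shifted_inverse_le \<epsilon>) simp
        also have "\<dots> \<le> (\<epsilon> / (2 * C) * norm h / \<epsilon>) * C"
          using C(1) \<epsilon> g'_close[OF u]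
          by (intro mult_right_mono divide_right_mono order_trans[OF norm_blinfun]) auto
        also have "\<dots> = (1/2) * norm h" using C(1) \<epsilon> by simp
        finally show "norm (h - Q (N u h - 0)) \<le> (1/2) * norm h" .
      qed simp
    qed
    have "\<exists>!x\<in>cball w \<rho>. \<phi> x = x"
    proof (rule Banach_fix)
      show "complete (cball w \<rho>)" by (simp add: complete_eq_closed)
      show "cball w \<rho> \<noteq> {}" using \<rho> by simp
      show "(0::real) \<le> 1/2" "(1/2::real) < 1" by simp_all
      show "dist (\<phi> x) (\<phi> y) \<le> (1/2) * dist x y" if "x \<in> cball w \<rho>" "y \<in> cball w \<rho>" for x y
        using lip[OF that] by (simp add: dist_norm)
      show "\<phi> ` cball w \<rho> \<subseteq> cball w \<rho>"
      proof safe
        fix x assume x: "x \<in> cball w \<rho>"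
        have "norm (\<phi> w - w) \<le> norm (q - p) * C"
          using C(2)[of "q - p"] by (simp add: \<phi>_def w)
        also have "\<dots> \<le> (\<rho> / (2 * C)) * C"
          using p C(1) by (intro mult_right_mono) (simp_all add: dist_norm)
        finally have "norm (\<phi> w - w) \<le> \<rho> / 2" using C(1) by simp
        moreover have "norm (\<phi> x - \<phi> w) \<le> \<rho> / 2"
          using lip[OF x, of w] x \<rho> by (simp add: dist_norm norm_minus_commute)
        ultimately have "norm (\<phi> x - w) \<le> \<rho>"
          using norm_triangle_ineq[of "\<phi> x - \<phi> w" "\<phi> w - w"] by simp
        then show "\<phi> x \<in> cball w \<rho>" by (simp add: dist_norm norm_minus_commute)
      qed
    qed
    then obtain x where "\<phi> x = x" by blast
    then have "Q (reg \<epsilon> x - p) = 0" by (simp add: \<phi>_def)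
    then have "reg \<epsilon> x - p = 0" using NQ[of "reg \<epsilon> x - p"] NQ[of 0] Q.zero by simp
    then show ?thesis by (metis eq_iff_diff_eq_0 rangeI)
  qed
  moreover have "\<rho> / (2 * C) > 0" using \<rho> C by simp
  ultimately show "\<exists>e>0. cball q e \<subseteq> range (reg \<epsilon>)" by blast
qed

section \<open>The global inverse of the regularized map\<close>

lemma bij_reg:
  assumes \<epsilon>: "\<epsilon> > 0"
  shows "bij (reg \<epsilon>)"
proof (rule bijI[OF inj_reg[OF \<epsilon>]])
  show "surj (reg \<epsilon>)"
    \<comment> \<open>A nonempty clopen subset of a connected space is the whole space.\<close>
    using connected_UNIV closed_range_reg[OF \<epsilon>] open_range_reg[OF \<epsilon>]
    unfolding connected_clopen subtopology_UNIV open_openin[symmetric] closed_closedin[symmetric]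
    by blast
qed

lemma reg_inv: "\<epsilon> > 0 \<Longrightarrow> reg \<epsilon> (inv (reg \<epsilon>) p) = p"
  and inv_reg: "\<epsilon> > 0 \<Longrightarrow> inv (reg \<epsilon>) (reg \<epsilon> u) = u"
  using bij_reg[of \<epsilon>] by (simp_all add: bij_def surj_f_inv_f)

text \<open>Writing the inverse at \<open>p\<close> as \<open>w + (p - q)\<close> plus an error,
  \<open>reg_inverse_estimate\<close> bounds the error by the variation of \<open>g\<close> at
  \<open>w\<close>, which vanishes as \<open>p\<close> tends to \<open>q\<close>.\<close>

lemma isCont_inv_reg:
  assumes \<epsilon>: "\<epsilon> > 0"
  shows "isCont (inv (reg \<epsilon>)) q"
proof -
  define w where "w = inv (reg \<epsilon>) q"
  have "((\<lambda>p. w + (p - q)) \<longlongrightarrow> w + (q - q)) (at q)" by (intro tendsto_intros)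
  then have "((\<lambda>p. g (w + (p - q))) \<longlongrightarrow> g w) (at q)"
    by (intro isCont_tendsto_compose[OF isCont_g]) simp
  then have "((\<lambda>p. norm (g (w + (p - q)) - g w) / \<epsilon>) \<longlongrightarrow> norm (g w - g w) / \<epsilon>) (at q)"
    using \<epsilon> by (intro tendsto_intros) auto
  then have lim: "((\<lambda>p. norm (g (w + (p - q)) - g w) / \<epsilon>) \<longlongrightarrow> 0) (at q)" by simp
  have "norm ((inv (reg \<epsilon>) p - w) - (p - q)) \<le> norm (g (w + (p - q)) - g w) / \<epsilon>" for p
    using reg_inverse_estimate[OF \<epsilon>, of "inv (reg \<epsilon>) p" w] \<epsilon>
    by (simp add: reg_inv w_def field_simps)
  then have "((\<lambda>p. (inv (reg \<epsilon>) p - w) - (p - q)) \<longlongrightarrow> 0) (at q)"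
    by (intro Lim_null_comparison[OF always_eventually lim]) blast
  then have "((\<lambda>p. ((inv (reg \<epsilon>) p - w) - (p - q)) + (w + (p - q))) \<longlongrightarrow> 0 + (w + (q - q))) (at q)"
    by (intro tendsto_intros)
  then show ?thesis by (simp add: isCont_def w_def)
qed

lemma inv_reg_has_derivative:
  assumes \<epsilon>: "\<epsilon> > 0"
  shows "(inv (reg \<epsilon>) has_derivative inv (newton_operator D L g' \<epsilon> (inv (reg \<epsilon>) p))) (at p)"
proof (rule has_derivative_inverse_basic[where T = UNIV])
  show "(reg \<epsilon> has_derivative newton_operator D L g' \<epsilon> (inv (reg \<epsilon>) p)) (at (inv (reg \<epsilon>) p))"
    by (rule reg_has_derivative[OF \<epsilon>])
  show "inv (newton_operator D L g' \<epsilon> (inv (reg \<epsilon>) p)) \<circ> newton_operator D L g' \<epsilon> (inv (reg \<epsilon>) p) = id"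
    by (rule inv_o_cancel[OF inj_newton_operator[OF \<epsilon>]])
qed (simp_all add: \<epsilon> bounded_linear_inv_newton_operator isCont_inv_reg reg_inv)

section \<open>The Newton flow and its limit\<close>

definition flow :: "real \<Rightarrow> 'a \<Rightarrow> real \<Rightarrow> 'a" where
  "flow \<epsilon> u\<^sub>0 t = inv (reg \<epsilon>) (exp (- t) *\<^sub>R reg \<epsilon> u\<^sub>0)"

lemma newton_field_eq:
  "newton_field D L g g' \<epsilon> u = - inv (newton_operator D L g' \<epsilon> u) (reg \<epsilon> u)"
  by (simp add: newton_field_def reg_def)

lemma flow_global_solution:
  assumes \<epsilon>: "\<epsilon> > 0"
  shows "global_solution (newton_field D L g g' \<epsilon>) u\<^sub>0 (flow \<epsilon> u\<^sub>0)"
  unfolding global_solution_def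
proof (intro conjI allI impI)
  show "flow \<epsilon> u\<^sub>0 0 = u\<^sub>0" by (simp add: flow_def inv_reg \<epsilon>)
  fix t :: real
  let ?p = "exp (- t) *\<^sub>R reg \<epsilon> u\<^sub>0"
  let ?Q = "inv (newton_operator D L g' \<epsilon> (flow \<epsilon> u\<^sub>0 t))"
  interpret Q: bounded_linear ?Q by (rule bounded_linear_inv_newton_operator[OF \<epsilon>])
  have "((\<lambda>t. exp (- t) *\<^sub>R reg \<epsilon> u\<^sub>0) has_derivative (\<lambda>s. s *\<^sub>R (- ?p))) (at t)"
    by (auto intro!: derivative_eq_intros)
  then have "(flow \<epsilon> u\<^sub>0 has_derivative (\<lambda>s. ?Q (s *\<^sub>R (- ?p)))) (at t)"
    unfolding flow_def by (rule has_derivative_compose) (rule inv_reg_has_derivative[OF \<epsilon>])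
  then have "(flow \<epsilon> u\<^sub>0 has_vector_derivative - ?Q ?p) (at t)"
    unfolding has_vector_derivative_def
    by (rule has_derivative_eq_rhs) (simp only: Q.scaleR Q.neg)
  \<comment> \<open>Hence \<open>?p\<close> may be read as the regularized map at the current point,
    which turns the computed derivative into the Newton field.\<close>
  moreover have "reg \<epsilon> (flow \<epsilon> u\<^sub>0 t) = ?p" by (simp add: flow_def reg_inv \<epsilon>)
  ultimately have "(flow \<epsilon> u\<^sub>0 has_vector_derivative newton_field D L g g' \<epsilon> (flow \<epsilon> u\<^sub>0 t)) (at t)"
    by (simp add: newton_field_eq)
  then show "(flow \<epsilon> u\<^sub>0 has_vector_derivative newton_field D L g g' \<epsilon> (flow \<epsilon> u\<^sub>0 t)) (at t within {0..})"
    by (rule has_vector_derivative_at_within)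
qed

text \<open>Along any solution the linearization applied to the field is minus the regularized map,
  so \<open>exp t *\<^sub>R reg \<epsilon> (w t)\<close> has zero derivative and is constant;
  injectivity of \<open>reg \<epsilon>\<close> then determines \<open>w t\<close>.\<close>

lemma global_solution_unique:
  assumes \<epsilon>: "\<epsilon> > 0" and w: "global_solution (newton_field D L g g' \<epsilon>) u\<^sub>0 w" and t: "t \<ge> 0"
  shows "w t = flow \<epsilon> u\<^sub>0 t"
proof -
  let ?y = "\<lambda>t. exp t *\<^sub>R reg \<epsilon> (w t)"
  have "?y t = ?y 0"
  proof (rule has_derivative_zero_unique[where s = "{0..}"])
    fix s :: real assume s: "s \<in> {0..}"
    let ?N = "newton_operator D L g' \<epsilon> (w s)" and ?\<Phi> = "newton_field D L g g' \<epsilon> (w s)"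
    interpret N: bounded_linear ?N by (rule bounded_linear_newton_operator[OF \<epsilon>])
    have N\<Phi>: "?N ?\<Phi> = - reg \<epsilon> (w s)"
      using bij_newton_operator[OF \<epsilon>, of "w s"]
      by (simp add: newton_field_eq N.neg bij_def surj_f_inv_f)
    have "(w has_derivative (\<lambda>h. h *\<^sub>R ?\<Phi>)) (at s within {0..})"
      using w s by (simp add: global_solution_def has_vector_derivative_def)
    then have "((\<lambda>s. reg \<epsilon> (w s)) has_derivative (\<lambda>h. ?N (h *\<^sub>R ?\<Phi>))) (at s within {0..})"
      by (rule has_derivative_compose) (rule reg_has_derivative[OF \<epsilon>])
    then have "(?y has_derivative (\<lambda>h. exp s *\<^sub>R ?N (h *\<^sub>R ?\<Phi>) + (h * exp s) *\<^sub>R reg \<epsilon> (w s)))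
        (at s within {0..})"
      by (auto intro!: derivative_eq_intros)
    then show "(?y has_derivative (\<lambda>h. 0)) (at s within {0..})"
      by (rule has_derivative_eq_rhs) (simp add: N.scaleR N\<Phi> mult.commute)
  qed (use t in auto)
  also have "\<dots> = reg \<epsilon> u\<^sub>0" using w by (simp add: global_solution_def)
  finally have "exp (- t) *\<^sub>R ?y t = exp (- t) *\<^sub>R reg \<epsilon> u\<^sub>0" by simp
  then have "reg \<epsilon> (w t) = exp (- t) *\<^sub>R reg \<epsilon> u\<^sub>0" by (simp flip: exp_add)
  then show ?thesis using inv_reg[OF \<epsilon>, of "w t"] by (simp add: flow_def)
qed

lemma flow_tendsto:
  assumes \<epsilon>: "\<epsilon> > 0"
  shows "(flow \<epsilon> u\<^sub>0 \<longlongrightarrow> inv (reg \<epsilon>) 0) at_top"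
proof -
  have "((\<lambda>t::real. exp (- t)) \<longlongrightarrow> 0) at_top"
    by (rule filterlim_compose[OF exp_at_bot filterlim_uminus_at_bot_at_top])
  then have "((\<lambda>t. exp (- t) *\<^sub>R reg \<epsilon> u\<^sub>0) \<longlongrightarrow> 0 *\<^sub>R reg \<epsilon> u\<^sub>0) at_top"
    by (intro tendsto_intros)
  then show ?thesis
    unfolding flow_def by (intro isCont_tendsto_compose[OF isCont_inv_reg[OF \<epsilon>]]) simp
qed

section \<open>Regularized solutions as the parameter tends to zero\<close>

lemma inv_reg_0:
  assumes "\<epsilon> > 0"
  shows "inv (reg \<epsilon>) 0 \<in> D" "shifted \<epsilon> (inv (reg \<epsilon>) 0) + g (inv (reg \<epsilon>) 0) = 0"
proof -
  let ?v = "inv (reg \<epsilon>) 0"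
  have v: "- ?v \<in> D" "shifted \<epsilon> (0 - ?v) = g ?v"
    using reg_eq_iff[OF assms, of ?v 0] by (simp_all add: reg_inv assms)
  then show "?v \<in> D" using subspace_neg[OF subspace_D, of "- ?v"] by simp
  have "shifted \<epsilon> 0 - shifted \<epsilon> ?v = g ?v"
    using v(2) unfolding shifted_diff[OF subspace_0[OF subspace_D] \<open>?v \<in> D\<close>] .
  then show "shifted \<epsilon> ?v + g ?v = 0" by (simp add: L_0 flip: \<open>shifted \<epsilon> 0 - shifted \<epsilon> ?v = g ?v\<close>)
qed

lemma L_add_g_monotone:
  assumes "x \<in> D" "y \<in> D"
  shows "0 \<le> ((L x + g x) - (L y + g y)) \<bullet> (x - y)"
  using L_nonneg[of "x - y"] g_monotone[of x y] assms subspace_diff[OF subspace_D assms]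
  by (simp add: L_diff inner_diff_left inner_add_left)

text \<open>Monotonicity of \<open>L + g\<close> between the regularized solution and
  \<open>w\<close>, divided by \<epsilon>. The inequality bounds the norm of the regularized
  solution by \<open>norm w\<close> uniformly in \<epsilon>.\<close>

lemma inv_reg_0_inner_solution:
  assumes \<epsilon>: "\<epsilon> > 0" and w: "equation_solution D L g w"
  shows "inv (reg \<epsilon>) 0 \<bullet> (inv (reg \<epsilon>) 0 - w) \<le> 0"
proof -
  let ?v = "inv (reg \<epsilon>) 0"
  have "L ?v + g ?v = - (\<epsilon> *\<^sub>R ?v)"
    using inv_reg_0(2)[OF \<epsilon>] by (simp add: eq_neg_iff_add_eq_0 algebra_simps)
  then have "0 \<le> - (\<epsilon> *\<^sub>R ?v) \<bullet> (?v - w)"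
    using L_add_g_monotone[OF inv_reg_0(1)[OF \<epsilon>], of w] w
    unfolding equation_solution_def by simp
  then show ?thesis using \<epsilon> by (simp add: mult_le_0_iff)
qed

text \<open>Monotonicity of \<open>L + g\<close> shows that the solution for \<delta> has
  nonnegative inner product with the difference of the two solutions; expanding the squares gives
  the claim. In particular norms grow as \<epsilon> decreases, and their growth controls
  distances.\<close>

lemma inv_reg_0_dist:
  assumes \<epsilon>: "0 < \<epsilon>" "\<epsilon> \<le> \<delta>"
  shows "(norm (inv (reg \<epsilon>) 0 - inv (reg \<delta>) 0))\<^sup>2
    \<le> (norm (inv (reg \<epsilon>) 0))\<^sup>2 - (norm (inv (reg \<delta>) 0))\<^sup>2"
proof (cases "\<epsilon> = \<delta>")
  case False
  let ?a = "inv (reg \<epsilon>) 0" and ?b = "inv (reg \<delta>) 0"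
  have \<delta>: "\<delta> > 0" "\<delta> - \<epsilon> > 0" using assms False by auto
  have "L ?a + g ?a = - (\<epsilon> *\<^sub>R ?a)" "L ?b + g ?b = - (\<delta> *\<^sub>R ?b)"
    using inv_reg_0(2)[OF \<epsilon>(1)] inv_reg_0(2)[OF \<delta>(1)]
    by (simp_all add: eq_neg_iff_add_eq_0 algebra_simps)
  then have "0 \<le> (\<delta> *\<^sub>R ?b - \<epsilon> *\<^sub>R ?a) \<bullet> (?a - ?b)"
    using L_add_g_monotone[OF inv_reg_0(1)[OF \<epsilon>(1)] inv_reg_0(1)[OF \<delta>(1)]] by simp
  also have "\<delta> *\<^sub>R ?b - \<epsilon> *\<^sub>R ?a = (\<delta> - \<epsilon>) *\<^sub>R ?b - \<epsilon> *\<^sub>R (?a - ?b)" by (simp add: algebra_simps)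
  also have "\<dots> \<bullet> (?a - ?b) = (\<delta> - \<epsilon>) * (?b \<bullet> (?a - ?b)) - \<epsilon> * (norm (?a - ?b))\<^sup>2"
    by (simp add: inner_diff_left[of "_ *\<^sub>R _"] power2_norm_eq_inner)
  finally have "0 \<le> (\<delta> - \<epsilon>) * (?b \<bullet> (?a - ?b))"
    using \<epsilon>(1) by (smt (verit) mult_nonneg_nonneg zero_le_power2)
  then have "0 \<le> ?b \<bullet> (?a - ?b)" using \<delta>(2) by (simp add: zero_le_mult_iff)
  then show ?thesis
    by (simp add: power2_norm_eq_inner inner_diff_left inner_diff_right inner_commute)
qed simp

lemma inv_reg_0_tendsto_minimal:
  assumes ex: "\<exists>w. equation_solution D L g w"
  obtains v where "minimal_norm_solution D L g v"
    "\<And>w. minimal_norm_solution D L g w \<Longrightarrow> w = v"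
    "((\<lambda>\<epsilon>. inv (reg \<epsilon>) 0) \<longlongrightarrow> v) (at_right 0)"
proof -
  define V where "V \<epsilon> = inv (reg \<epsilon>) 0" for \<epsilon>
  have V_dist: "(norm (V \<epsilon> - V \<delta>))\<^sup>2 \<le> (norm (V \<epsilon>))\<^sup>2 - (norm (V \<delta>))\<^sup>2" if "0 < \<epsilon>" "\<epsilon> \<le> \<delta>" for \<epsilon> \<delta>
    unfolding V_def by (rule inv_reg_0_dist[OF that])
  have V_inner: "V \<epsilon> \<bullet> (V \<epsilon> - w) \<le> 0" if "\<epsilon> > 0" "equation_solution D L g w" for \<epsilon> w
    unfolding V_def by (rule inv_reg_0_inner_solution[OF that])
  have V_norm: "(norm (w - V \<epsilon>))\<^sup>2 \<le> (norm w)\<^sup>2 - (norm (V \<epsilon>))\<^sup>2"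
    if "\<epsilon> > 0" "equation_solution D L g w" for \<epsilon> w
    using V_inner[OF that]
    by (simp add: power2_norm_eq_inner inner_diff_left inner_diff_right inner_commute)
  \<comment> \<open>Along this decreasing sequence the squared norms are increasing and bounded,
    hence Cauchy, and they control the distances between the regularized solutions.\<close>
  define e where "e n = 1 / real (Suc n)" for n
  have e: "e n > 0" "m \<le> n \<Longrightarrow> e n \<le> e m" for m n by (auto simp: e_def frac_le)
  have e0: "e \<longlonglongrightarrow> 0" unfolding e_def by (rule LIMSEQ_Suc[OF lim_const_over_n])
  define S where "S n = (norm (V (e n)))\<^sup>2" for n
  have "incseq S"
  proof (rule incseq_SucI)
    show "S n \<le> S (Suc n)" for n
      using order_trans[OF zero_le_power2 V_dist[OF e(1) e(2)[of n "Suc n"]]] unfolding S_def by simp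
  qed
  obtain w where w: "equation_solution D L g w" using ex by blast
  have "S n \<le> (norm w)\<^sup>2" for n
    using order_trans[OF zero_le_power2 V_norm[OF e(1) w, of n]] unfolding S_def by simp
  then have "convergent S"
    using incseq_convergent[OF \<open>incseq S\<close>] by (metis convergentI)
  then have "Cauchy S" by (rule convergent_Cauchy)
  then have "Cauchy (\<lambda>n. V (e n))"
  proof (rule Cauchy_if_dist_power2_le)
    show "(dist (V (e m)) (V (e n)))\<^sup>2 \<le> 1 * dist (S m) (S n)" for m n
    proof (cases "m \<le> n")
      case True
      then show ?thesis
        using V_dist[OF e(1) e(2)[OF True]] by (simp add: S_def dist_norm norm_minus_commute)
    next
      case False
      then show ?thesis
        using V_dist[OF e(1) e(2)[of n m]] by (simp add: S_def dist_norm)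
    qed
  qed
  then obtain v where v: "(\<lambda>n. V (e n)) \<longlonglongrightarrow> v" by (auto simp: convergent_eq_Cauchy[symmetric])
  have LV: "L (V (e n)) = - (e n *\<^sub>R V (e n)) - g (V (e n))" for n
    using inv_reg_0(2)[OF e(1)] by (simp add: V_def algebra_simps eq_neg_iff_add_eq_0)
  have "(\<lambda>n. - (e n *\<^sub>R V (e n)) - g (V (e n))) \<longlonglongrightarrow> - (0 *\<^sub>R v) - g v"
    by (intro tendsto_intros e0 v isCont_tendsto_compose[OF isCont_g])
  then have "(\<lambda>n. L (V (e n))) \<longlonglongrightarrow> - g v" by (simp add: LV)
  from closed_operator[OF _ v this] have sol: "equation_solution D L g v"
    using inv_reg_0(1)[OF e(1)] by (simp add: V_def equation_solution_def)
  \<comment> \<open>This variational inequality survives the limit and yields both minimality of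
    \<open>v\<close> and its uniqueness among minimal-norm solutions.\<close>
  have v_inner: "v \<bullet> (v - u) \<le> 0" if "equation_solution D L g u" for u
  proof (rule LIMSEQ_le_const2)
    show "(\<lambda>n. V (e n) \<bullet> (V (e n) - u)) \<longlonglongrightarrow> v \<bullet> (v - u)" by (intro tendsto_intros v)
  qed (use V_inner[OF e(1) that] in blast)
  have v_norm: "(norm (u - v))\<^sup>2 \<le> (norm u)\<^sup>2 - (norm v)\<^sup>2" if "equation_solution D L g u" for u
    using v_inner[OF that]
    by (simp add: power2_norm_eq_inner inner_diff_left inner_diff_right inner_commute)
  have le: "norm v \<le> norm u" if "equation_solution D L g u" for u
    using order_trans[OF zero_le_power2 v_norm[OF that]] by simp
  show thesis
  proof (rule that[of v])
    show "minimal_norm_solution D L g v" using sol le by (simp add: minimal_norm_solution_def)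
    show "u = v" if u: "minimal_norm_solution D L g u" for u
    proof -
      have u': "equation_solution D L g u" "norm u \<le> norm v"
        using u sol by (simp_all add: minimal_norm_solution_def)
      have "(norm (u - v))\<^sup>2 \<le> 0"
        using v_norm[OF u'(1)] power_mono[OF u'(2) norm_ge_zero, of 2] by linarith
      then show ?thesis by simp
    qed
    show "((\<lambda>\<epsilon>. inv (reg \<epsilon>) 0) \<longlongrightarrow> v) (at_right 0)"
      unfolding V_def[symmetric]
    proof (rule tendstoI)
      fix r :: real assume r: "r > 0"
      have "(\<lambda>n. (norm v)\<^sup>2 - S n) \<longlonglongrightarrow> (norm v)\<^sup>2 - (norm v)\<^sup>2"
        unfolding S_def by (intro tendsto_intros v)
      then have "\<forall>\<^sub>F n in sequentially. (norm v)\<^sup>2 - S n < r\<^sup>2"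
        using r by (intro order_tendstoD(2)) auto
      then obtain n where n: "(norm v)\<^sup>2 - S n < r\<^sup>2" by (auto simp: eventually_sequentially)
      \<comment> \<open>Passage from the sequence to all small \<epsilon>: the squared norm of
        \<open>V \<epsilon>\<close> lies between \<open>S n\<close> and that of \<open>v\<close>,
        and \<open>V_norm\<close> with the solution \<open>v\<close> converts this gap into a
        distance.\<close>
      have close: "dist (V \<epsilon>) v < r" if \<epsilon>: "0 < \<epsilon>" "\<epsilon> < e n" for \<epsilon>
      proof -
        have "S n \<le> (norm (V \<epsilon>))\<^sup>2"
          using V_dist[of \<epsilon> "e n"] \<epsilon> zero_le_power2[of "norm (V \<epsilon> - V (e n))"] unfolding S_def by linarith
        then have "(norm (v - V \<epsilon>))\<^sup>2 < r\<^sup>2" using V_norm[OF \<epsilon>(1) sol] n by linarith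
        then show ?thesis
          using r power_less_imp_less_base by (fastforce simp: dist_norm norm_minus_commute)
      qed
      then show "\<forall>\<^sub>F \<epsilon> in at_right 0. dist (V \<epsilon>) v < r"
        unfolding eventually_at_right_field by (intro exI[of _ "e n"]) (simp add: e(1) close)
    qed
  qed
qed

end

theorem theorem1p2:
  fixes u\<^sub>0 :: "'a::{real_inner, complete_space}"
    and R :: real
    and D :: "'a set"
    and L g :: "'a \<Rightarrow> 'a"
    and g' :: "'a \<Rightarrow> 'a \<Rightarrow>\<^sub>L 'a"
    and g'' :: "'a \<Rightarrow> 'a \<Rightarrow>\<^sub>L ('a \<Rightarrow>\<^sub>L 'a)"
  assumes "R > 0"
    and "linear_operator_on D L"
    and "densely_defined D"
    and "selfadjoint_operator D L"
    and "nonneg_operator D L"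
    and "C2_loc u\<^sub>0 R g g' g''"
    and "\<And>u. nonneg_operator UNIV (blinfun_apply (g' u))"
    and "\<exists>w. equation_solution D L g w"
    and "\<And>\<epsilon>. \<epsilon> > 0 \<Longrightarrow> \<exists>m\<^sub>1>0. \<forall>u\<in>cball u\<^sub>0 R.
           boundedly_invertible (newton_operator D L g' \<epsilon> u) \<and>
           onorm (inv (newton_operator D L g' \<epsilon> u)) \<le> m\<^sub>1"
  shows "\<exists>v\<^sub>\<epsilon> :: real \<Rightarrow> 'a.
     (\<forall>\<epsilon>>0.
        (\<exists>u. global_solution (newton_field D L g g' \<epsilon>) u\<^sub>0 u \<and>
             (\<forall>w. global_solution (newton_field D L g g' \<epsilon>) u\<^sub>0 w \<longrightarrow> (\<forall>t\<ge>0. w t = u t)) \<and>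
             (u \<longlongrightarrow> v\<^sub>\<epsilon> \<epsilon>) at_top) \<and>
        v\<^sub>\<epsilon> \<epsilon> \<in> D \<and> L (v\<^sub>\<epsilon> \<epsilon>) + \<epsilon> *\<^sub>R v\<^sub>\<epsilon> \<epsilon> + g (v\<^sub>\<epsilon> \<epsilon>) = 0) \<and>
     (\<exists>v. minimal_norm_solution D L g v \<and>
          (\<forall>w. minimal_norm_solution D L g w \<longrightarrow> w = v) \<and>
          (v\<^sub>\<epsilon> \<longlongrightarrow> v) (at_right 0))"
proof -
  interpret monotone_equation D L g g'
  proof
    show "(g has_derivative blinfun_apply (g' u)) (at u)" for u
      using assms(6) by (simp add: C2_loc_def)
    have "(g' has_derivative blinfun_apply (g'' u)) (at u)" for u
      using assms(6) by (simp add: C2_loc_def)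
    then show "isCont g' u" for u by (rule has_derivative_continuous)
    show "0 \<le> g' u h \<bullet> h" for u h using assms(7) by (simp add: nonneg_operator_def)
  qed fact+
  obtain v where "minimal_norm_solution D L g v"
    "\<And>w. minimal_norm_solution D L g w \<Longrightarrow> w = v"
    "((\<lambda>\<epsilon>. inv (reg \<epsilon>) 0) \<longlongrightarrow> v) (at_right 0)"
    using inv_reg_0_tendsto_minimal[OF assms(8)] by blast
  moreover have "\<exists>u. global_solution (newton_field D L g g' \<epsilon>) u\<^sub>0 u \<and>
      (\<forall>w. global_solution (newton_field D L g g' \<epsilon>) u\<^sub>0 w \<longrightarrow> (\<forall>t\<ge>0. w t = u t)) \<and>
      (u \<longlongrightarrow> inv (reg \<epsilon>) 0) at_top" if "\<epsilon> > 0" for \<epsilon>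
    using flow_global_solution[OF that] global_solution_unique[OF that] flow_tendsto[OF that] by blast
  ultimately show ?thesis
    using inv_reg_0 by (intro exI[of _ "\<lambda>\<epsilon>. inv (reg \<epsilon>) 0"]) blast
qed

end
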